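(* Let $C$, $D$ and $E$ be permutation classes satisfying $C\subseteq D\odot_{\mathrm{LR}}E$. Then $C^{\mathrm{LR}}\subseteq D^{\mathrm{LR}}\odot_{\mathrm{LR}}E^{\mathrm{LR}}$. Consequently, if neither $D^{\mathrm{LR}}$ nor $E^{\mathrm{LR}}$ contains the whole class $C$, then $C^{\mathrm{LR}}$ is LR-splittable into parts $D^{\mathrm{LR}}$ and $E^{\mathrm{LR}}$, i.e. $\{D^{\mathrm{LR}},E^{\mathrm{LR}}\}$ is a nontrivial LR-splitting of $C^{\mathrm{LR}}$.
   Context: A permutation of length $n\ge 1$ is a sequence of all the $n$ distinct numbers of $[n]=\{1,\dots,n\}$. A permutation $\pi$ contains $\sigma$ if some subsequence of $\pi$ is order-isomorphic to $\sigma$ (has the same relative order). A permutation class is a set of permutations closed under taking contained permutations. For a permutation $\pi$ of length $n$ and non-empty permutations $\sigma_1,\dots,\sigma_n$, the inflation $\pi[\sigma_1,\dots,\sigma_n]$ is the permutation that is a concatenation of blocks $\overline\sigma_1\cdots\overline\sigma_n$, where $\overline\sigma_i$ is order-isomorphic to $\sigma_i$, and whenever $\pi_i<\pi_j$ all elements of $\overline\sigma_i$ are smaller than all elements of $\overline\sigma_j$. An element $\pi_i$ is a left-to-right minimum (LR-minimum) of $\pi$ if it is smaller than all elements preceding it. If $\pi$ has $k$ LR-minima and $\sigma_1,\dots,\sigma_k$ are non-empty permutations, the LR-inflation $\pi\langle\sigma_1,\dots,\sigma_k\rangle$ is the permutation obtained by inflating the LR-minima of $\pi$ (taken from left to right)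 by $\sigma_1,\dots,\sigma_k$ and leaving every other element uninflated (i.e. inflated by the singleton permutation). A permutation class $C$ is closed under LR-inflations if for every $\pi\in C$ with $k$ LR-minima and all $\sigma_1,\dots,\sigma_k\in C$, we have $\pi\langle\sigma_1,\dots,\sigma_k\rangle\in C$. The closure of $C$ under LR-inflations, denoted $C^{\mathrm{LR}}$, is the smallest permutation class that contains $C$ and is closed under LR-inflations. A permutation $\pi$ is an LR-merge of permutations $\tau$ and $\sigma$ if the elements of $\pi$ that are not LR-minima can be partitioned into two disjoint (possibly empty) sequences such that one of them, together with all LR-minima of $\pi$, is an occurrence of $\tau$ (a subsequence order-isomorphic to $\tau$), and the other, together with all LR-minima of $\pi$, is an occurrence of $\sigma$. For permutation classes $A,B$, $A\odot_{\mathrm{LR}}B$ is the collection of all LR-merges of a permutation from $A$ with a permutation from $B$. A multiset $\{P_1,\dots,P_m\}$ of permutation classes is an LR-splitting of a permutation class $C$ if $C\subseteq P_1\odot_{\mathrm{LR}}\cdots\odot_{\mathrm{LR}}P_m$; it is nontrivial if no $P_i$ is a superset of $C$. $C$ is LR-splittable if it admits a nontrivial LR-splitting. *)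

theory Defs
  imports Main "HOL-Library.Multiset"
begin

text \<open>
  Permutations are written in one-line notation, as lists of natural numbers. Values run over
  \<open>1, \<dots>, n\<close> whereas positions are list indices \<open>0, \<dots>, n - 1\<close>.
\<close>

type_synonym perm = "nat list"

definition is_perm :: "perm \<Rightarrow> bool" where
  "is_perm \<pi> \<longleftrightarrow> length \<pi> \<ge> 1 \<and> distinct \<pi> \<and> set \<pi> = {1..length \<pi>}"

definition order_iso :: "nat list \<Rightarrow> nat list \<Rightarrow> bool" where
  "order_iso xs ys \<longleftrightarrow> length xs = length ys \<and>
     (\<forall>i<length xs. \<forall>j<length xs. xs ! i < xs ! j \<longleftrightarrow> ys ! i < ys ! j)"

text \<open>Subsequences are given by sets of positions: \<open>nths \<pi> I\<close>.\<close>

definition contains_perm :: "perm \<Rightarrow> perm \<Rightarrow> bool" where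
  "contains_perm \<pi> \<sigma> \<longleftrightarrow> (\<exists>I. order_iso (nths \<pi> I) \<sigma>)"

definition perm_class :: "perm set \<Rightarrow> bool" where
  "perm_class C \<longleftrightarrow> (\<forall>\<pi>\<in>C. is_perm \<pi>) \<and>
     (\<forall>\<pi>\<in>C. \<forall>\<sigma>. is_perm \<sigma> \<and> contains_perm \<pi> \<sigma> \<longrightarrow> \<sigma> \<in> C)"


subsection \<open>Inflations\<close>

text \<open>
  The block replacing \<open>\<pi> ! i\<close> is \<open>\<sigma>s ! i\<close>, shifted upwards by the total length of the blocks
  replacing smaller elements of \<open>\<pi>\<close>. The lemma \<open>inflation_iff\<close> below shows that this is the unique
  permutation with the properties usually taken as the definition.
\<close>

definition inflation_shift :: "perm \<Rightarrow> perm list \<Rightarrow> nat \<Rightarrow> nat" where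
  "inflation_shift \<pi> \<sigma>s i = (\<Sum>j | j < length \<pi> \<and> \<pi> ! j < \<pi> ! i. length (\<sigma>s ! j))"

definition inflation :: "perm \<Rightarrow> perm list \<Rightarrow> perm" where
  "inflation \<pi> \<sigma>s =
     concat (map (\<lambda>i. map (\<lambda>x. inflation_shift \<pi> \<sigma>s i + x) (\<sigma>s ! i)) [0..<length \<pi>])"

definition lr_minima :: "perm \<Rightarrow> nat set" where
  "lr_minima \<pi> = {i. i < length \<pi> \<and> (\<forall>j<i. \<pi> ! i < \<pi> ! j)}"

text \<open>
  For a position \<open>i\<close> of an LR-minimum, \<open>card {j \<in> lr_minima \<pi>. j < i}\<close> is its (zero-based) index in
  the left-to-right enumeration of the LR-minima.
\<close>

definition lr_inflation :: "perm \<Rightarrow> perm list \<Rightarrow> perm" where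
  "lr_inflation \<pi> \<sigma>s = inflation \<pi>
     (map (\<lambda>i. if i \<in> lr_minima \<pi> then \<sigma>s ! card {j \<in> lr_minima \<pi>. j < i} else [1])
        [0..<length \<pi>])"

definition lr_inflation_closed :: "perm set \<Rightarrow> bool" where
  "lr_inflation_closed C \<longleftrightarrow>
     (\<forall>\<pi>\<in>C. \<forall>\<sigma>s. length \<sigma>s = card (lr_minima \<pi>) \<and> set \<sigma>s \<subseteq> C \<longrightarrow> lr_inflation \<pi> \<sigma>s \<in> C)"

definition lr_closure :: "perm set \<Rightarrow> perm set" where
  "lr_closure C = \<Inter> {D. perm_class D \<and> C \<subseteq> D \<and> lr_inflation_closed D}"


subsection \<open>LR-merges and LR-splittings\<close>

definition is_lr_merge :: "perm \<Rightarrow> perm \<Rightarrow> perm \<Rightarrow> bool" where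
  "is_lr_merge \<pi> \<tau> \<sigma> \<longleftrightarrow>
     (\<exists>I J. I \<union> J = {..<length \<pi>} - lr_minima \<pi> \<and> I \<inter> J = {} \<and>
        order_iso (nths \<pi> (I \<union> lr_minima \<pi>)) \<tau> \<and>
        order_iso (nths \<pi> (J \<union> lr_minima \<pi>)) \<sigma>)"

definition lr_merge :: "perm set \<Rightarrow> perm set \<Rightarrow> perm set" (infixl "\<odot>\<^sub>L\<^sub>R" 70) where
  "A \<odot>\<^sub>L\<^sub>R B = {\<pi>. is_perm \<pi> \<and> (\<exists>\<tau>\<in>A. \<exists>\<sigma>\<in>B. is_lr_merge \<pi> \<tau> \<sigma>)}"

text \<open>
  The operation \<open>\<odot>\<^sub>L\<^sub>R\<close> is commutative and associative on permutation classes, so the choice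
  of the enumeration \<open>P # Ps\<close> of the multiset is immaterial in the following definition.
\<close>

definition lr_splitting :: "perm set \<Rightarrow> perm set multiset \<Rightarrow> bool" where
  "lr_splitting C M \<longleftrightarrow> perm_class C \<and> (\<forall>P\<in>#M. perm_class P) \<and>
     (\<exists>P Ps. M = mset (P # Ps) \<and> C \<subseteq> foldl (\<odot>\<^sub>L\<^sub>R) P Ps)"

definition nontrivial_lr_splitting :: "perm set \<Rightarrow> perm set multiset \<Rightarrow> bool" where
  "nontrivial_lr_splitting C M \<longleftrightarrow> lr_splitting C M \<and> (\<forall>P\<in>#M. \<not> C \<subseteq> P)"

definition lr_splittable :: "perm set \<Rightarrow> bool" where
  "lr_splittable C \<longleftrightarrow> (\<exists>M. nontrivial_lr_splitting C M)"


subsection \<open>Adequacy of the definitions\<close>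

lemma order_iso_same_set:
  assumes iso: "order_iso xs ys" and d: "distinct xs" "distinct ys" and s: "set xs = set ys"
  shows "xs = ys"
proof (rule nth_equalityI)
  show l: "length xs = length ys" using iso by (simp add: order_iso_def)
  fix i assume i: "i < length xs"
  have rank: "card {y \<in> set zs. y < zs ! i} = card {j. j < length zs \<and> zs ! j < zs ! i}"
    if "distinct zs" for zs :: "nat list"
  proof -
    have "{y \<in> set zs. y < zs ! i} = (\<lambda>j. zs ! j) ` {j. j < length zs \<and> zs ! j < zs ! i}"
      unfolding set_conv_nth by blast
    moreover have "inj_on (\<lambda>j. zs ! j) {j. j < length zs \<and> zs ! j < zs ! i}"
      using that by (simp add: inj_on_def nth_eq_iff_index_eq)
    ultimately show ?thesis by (simp only: card_image)
  qed
  have "{j. j < length xs \<and> xs ! j < xs ! i} = {j. j < length ys \<and> ys ! j < ys ! i}"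
    using iso i unfolding order_iso_def by (intro Collect_cong) metis
  then have c: "card {y \<in> set xs. y < xs ! i} = card {y \<in> set xs. y < ys ! i}"
    unfolding rank[OF d(1)] rank[OF d(2), folded s] by (rule arg_cong)
  have lt: False if "a < b" "a \<in> set xs"
    "card {y \<in> set xs. y < a} = card {y \<in> set xs. y < b}" for a b
  proof -
    have "{y \<in> set xs. y < a} \<subset> {y \<in> set xs. y < b}" using that(1,2) by auto
    then have "card {y \<in> set xs. y < a} < card {y \<in> set xs. y < b}"
      by (intro psubset_card_mono) auto
    then show False using that(3) by linarith
  qed
  have "xs ! i \<in> set xs" using i by (rule nth_mem)
  then have "\<not> xs ! i < ys ! i" using lt[OF _ _ c] by (intro notI)
  moreover have "ys ! i \<in> set xs" unfolding s using i l by (intro nth_mem) simp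
  then have "\<not> ys ! i < xs ! i" using lt[OF _ _ c[symmetric]] by (intro notI)
  ultimately show "xs ! i = ys ! i" by linarith
qed

lemma initial_segment_card:
  fixes A :: "nat set"
  assumes "A \<subseteq> {1..N}" "\<And>x y. x \<in> A \<Longrightarrow> 1 \<le> y \<Longrightarrow> y < x \<Longrightarrow> y \<in> A"
  shows "A = {1..card A}"
proof (cases "A = {}")
  case False
  have fin: "finite A" using assms(1) finite_subset by blast
  have "A = {1..Max A}"
  proof
    show "A \<subseteq> {1..Max A}" using assms(1) fin by auto
    show "{1..Max A} \<subseteq> A"
    proof
      fix y assume "y \<in> {1..Max A}"
      then show "y \<in> A" using assms(2)[of "Max A" y] Max_in[OF fin False]
        by (cases "y = Max A") auto
    qed
  qed
  moreover from this have "card A = card {1..Max A}" by (rule arg_cong)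
  ultimately show ?thesis by (metis card_atLeastAtMost diff_Suc_1)
qed simp

definition inflation_blocks :: "perm \<Rightarrow> perm list \<Rightarrow> perm \<Rightarrow> nat list list \<Rightarrow> bool" where
  "inflation_blocks \<pi> \<sigma>s \<rho> bs \<longleftrightarrow> \<rho> = concat bs \<and> length bs = length \<pi> \<and>
     (\<forall>i<length \<pi>. order_iso (bs ! i) (\<sigma>s ! i)) \<and>
     (\<forall>i<length \<pi>. \<forall>j<length \<pi>. \<pi> ! i < \<pi> ! j \<longrightarrow>
        (\<forall>x\<in>set (bs ! i). \<forall>y\<in>set (bs ! j). x < y))"

context
  fixes \<pi> :: perm and \<sigma>s :: "perm list"
  assumes p: "is_perm \<pi>" and len: "length \<sigma>s = length \<pi>" and ps: "\<forall>\<sigma>\<in>set \<sigma>s. is_perm \<sigma>"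
begin

lemma inflation_is_inflation:
  "is_perm (inflation \<pi> \<sigma>s)" "\<exists>bs. inflation_blocks \<pi> \<sigma>s (inflation \<pi> \<sigma>s) bs"
proof -
  let ?n = "length \<pi>" and ?o = "inflation_shift \<pi> \<sigma>s"
  let ?b = "\<lambda>i. map (\<lambda>x. ?o i + x) (\<sigma>s ! i)"
  let ?bs = "map ?b [0..<?n]"
  let ?N = "\<Sum>j<?n. length (\<sigma>s ! j)"
  have perm: "is_perm (\<sigma>s ! i)" if "i < ?n" for i using that len ps by simp
  have rng: "1 \<le> x \<and> x \<le> length (\<sigma>s ! i)" if "i < ?n" "x \<in> set (\<sigma>s ! i)" for i x
    using perm[OF that(1)] that(2) by (simp add: is_perm_def)
  have step: "?o i + length (\<sigma>s ! i) \<le> sum (\<lambda>j. length (\<sigma>s ! j)) S"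
    if "i < ?n" "{j. j < ?n \<and> \<pi> ! j < \<pi> ! i} \<subseteq> S" "i \<in> S" "finite S" for i S
  proof -
    have "?o i + length (\<sigma>s ! i) = sum (\<lambda>j. length (\<sigma>s ! j)) (insert i {j. j < ?n \<and> \<pi> ! j < \<pi> ! i})"
      by (simp add: inflation_shift_def)
    also have "\<dots> \<le> sum (\<lambda>j. length (\<sigma>s ! j)) S"
      using that by (intro sum_mono2) auto
    finally show ?thesis .
  qed
  have sep: "x < y" if "i < ?n" "j < ?n" "\<pi> ! i < \<pi> ! j" "x \<in> set (?b i)" "y \<in> set (?b j)" for i j x y
  proof -
    have "?o i + length (\<sigma>s ! i) \<le> ?o j" unfolding inflation_shift_def[of _ _ j]
      using that by (intro step) auto
    moreover from that(4) obtain u where u: "x = ?o i + u" "u \<in> set (\<sigma>s ! i)" by auto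
    moreover from that(5) obtain v where v: "y = ?o j + v" "v \<in> set (\<sigma>s ! j)" by auto
    moreover have "u \<le> length (\<sigma>s ! i)" "1 \<le> v"
      using rng[OF that(1) u(2)] rng[OF that(2) v(2)] by blast+
    ultimately show ?thesis by linarith
  qed
  have inf: "inflation \<pi> \<sigma>s = concat ?bs" by (simp add: inflation_def)
  have "inflation_blocks \<pi> \<sigma>s (inflation \<pi> \<sigma>s) ?bs"
    unfolding inflation_blocks_def inf
  proof (intro conjI allI impI ballI)
    fix i assume "i < ?n"
    then show "order_iso (?bs ! i) (\<sigma>s ! i)" by (simp add: order_iso_def)
  next
    fix i j x y
    assume ij: "i < ?n" "j < ?n" "\<pi> ! i < \<pi> ! j" and xy: "x \<in> set (?bs ! i)" "y \<in> set (?bs ! j)"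
    have "?bs ! i = ?b i" "?bs ! j = ?b j" using ij by simp_all
    then show "x < y" using sep[OF ij] xy by (simp only:)
  qed simp_all
  then show "\<exists>bs. inflation_blocks \<pi> \<sigma>s (inflation \<pi> \<sigma>s) bs" ..
  have dp: "distinct \<pi>" using p by (simp add: is_perm_def)
  have disj: "set (?b i) \<inter> set (?b j) = {}" if "i < ?n" "j < ?n" "i \<noteq> j" for i j
  proof -
    have "\<pi> ! i \<noteq> \<pi> ! j" using dp that by (simp add: nth_eq_iff_index_eq)
    then consider "\<pi> ! i < \<pi> ! j" | "\<pi> ! j < \<pi> ! i" by linarith
    then show ?thesis using sep[OF that(1,2)] sep[OF that(2,1)] by cases blast+
  qed
  have ne: "?b i \<noteq> []" if "i < ?n" for i using perm[OF that] by (auto simp: is_perm_def)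
  have dist: "distinct (concat ?bs)"
  proof (rule distinct_concat)
    show "distinct ?bs" unfolding distinct_map
    proof
      show "inj_on ?b (set [0..<?n])"
      proof (rule inj_onI)
        fix i j assume "i \<in> set [0..<?n]" "j \<in> set [0..<?n]" and e: "?b i = ?b j"
        then have "i < ?n" "j < ?n" by auto
        then show "i = j" using disj[of i j] ne[of i] e
          by (metis Int_absorb set_empty)
      qed
    qed simp
  next
    fix ys assume "ys \<in> set ?bs"
    then obtain i where "i < ?n" "ys = ?b i" by auto
    then show "distinct ys" using perm[of i] by (simp add: distinct_map is_perm_def)
  next
    fix ys zs assume "ys \<in> set ?bs" "zs \<in> set ?bs" "ys \<noteq> zs"
    moreover from this(1) obtain i where i: "i < ?n" "ys = ?b i" by auto
    moreover from \<open>zs \<in> set ?bs\<close> obtain j where j: "j < ?n" "zs = ?b j" by auto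
    ultimately have "i \<noteq> j" by blast
    then show "set ys \<inter> set zs = {}" unfolding i(2) j(2) by (rule disj[OF i(1) j(1)])
  qed
  have lenN: "length (concat ?bs) = ?N"
    by (simp add: length_concat comp_def interv_sum_list_conv_sum_set_nat lessThan_atLeast0)
  have sub: "set (concat ?bs) \<subseteq> {1..?N}"
  proof
    fix x assume "x \<in> set (concat ?bs)"
    then obtain i u where i: "i < ?n" and u: "u \<in> set (\<sigma>s ! i)" "x = ?o i + u" by auto
    have "?o i + length (\<sigma>s ! i) \<le> ?N" using i by (intro step) auto
    then show "x \<in> {1..?N}" using rng[OF i u(1)] u(2) by simp
  qed
  have "set (concat ?bs) = {1..?N}"
    using sub lenN distinct_card[OF dist] by (intro card_subset_eq) auto
  moreover have "?N \<ge> 1"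
  proof -
    have "?n > 0" using p unfolding is_perm_def by linarith
    moreover have "length (concat ?bs) > 0" using calculation ne[of 0] by auto
    ultimately show ?thesis using lenN by linarith
  qed
  ultimately show "is_perm (inflation \<pi> \<sigma>s)"
    using dist lenN unfolding is_perm_def inf by simp
qed

lemma inflation_iff:
  "\<rho> = inflation \<pi> \<sigma>s \<longleftrightarrow> is_perm \<rho> \<and> (\<exists>bs. inflation_blocks \<pi> \<sigma>s \<rho> bs)"
proof
  assume "\<rho> = inflation \<pi> \<sigma>s"
  then show "is_perm \<rho> \<and> (\<exists>bs. inflation_blocks \<pi> \<sigma>s \<rho> bs)" using inflation_is_inflation by simp
next
  assume "is_perm \<rho> \<and> (\<exists>bs. inflation_blocks \<pi> \<sigma>s \<rho> bs)"
  then obtain bs where pr: "is_perm \<rho>" and bs: "inflation_blocks \<pi> \<sigma>s \<rho> bs" by blast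
  let ?n = "length \<pi>" and ?o = "inflation_shift \<pi> \<sigma>s"
  from bs have rho: "\<rho> = concat bs" and lb: "length bs = ?n"
    and iso: "\<And>i. i < ?n \<Longrightarrow> order_iso (bs ! i) (\<sigma>s ! i)"
    and sep: "\<And>i j x y. i < ?n \<Longrightarrow> j < ?n \<Longrightarrow> \<pi> ! i < \<pi> ! j \<Longrightarrow> x \<in> set (bs ! i) \<Longrightarrow>
      y \<in> set (bs ! j) \<Longrightarrow> x < y"
    unfolding inflation_blocks_def by blast+
  have dp: "distinct \<pi>" using p by (simp add: is_perm_def)
  have ll: "length (bs ! i) = length (\<sigma>s ! i)" if "i < ?n" for i
    using iso[OF that] by (simp add: order_iso_def)
  have db: "distinct (bs ! i)" if "i < ?n" for i
    using pr that lb unfolding rho is_perm_def by (simp add: distinct_concat_iff)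
  have setr: "(\<Union>i<?n. set (bs ! i)) = {1..length \<rho>}"
  proof -
    have "set bs = (\<lambda>i. bs ! i) ` {..<?n}" using lb by (auto simp: in_set_conv_nth)
    then have "set \<rho> = (\<Union>i<?n. set (bs ! i))" unfolding rho by simp
    then show ?thesis using pr by (simp add: is_perm_def)
  qed
  have disj: "set (bs ! i) \<inter> set (bs ! j) = {}" if "i < ?n" "j < ?n" "i \<noteq> j" for i j
  proof -
    have "\<pi> ! i \<noteq> \<pi> ! j" using dp that by (simp add: nth_eq_iff_index_eq)
    then consider "\<pi> ! i < \<pi> ! j" | "\<pi> ! j < \<pi> ! i" by linarith
    then show ?thesis using sep[OF that(1,2)] sep[OF that(2,1)] by cases blast+
  qed
  have seg: "(\<Union>j\<in>S. set (bs ! j)) = {1..\<Sum>j\<in>S. length (\<sigma>s ! j)}"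
    if S: "S \<subseteq> {..<?n}" and down: "\<And>j k. j \<in> S \<Longrightarrow> k < ?n \<Longrightarrow> \<pi> ! k < \<pi> ! j \<Longrightarrow> k \<in> S" for S
  proof -
    let ?A = "\<Union>j\<in>S. set (bs ! j)"
    have "?A = {1..card ?A}"
    proof (rule initial_segment_card)
      show "?A \<subseteq> {1..length \<rho>}" unfolding setr[symmetric] using S by (rule UN_mono) simp
      fix x y assume x: "x \<in> ?A" and y: "1 \<le> y" "y < x"
      from x obtain j where j: "j \<in> S" "x \<in> set (bs ! j)" by blast
      have "x \<le> length \<rho>" 
      proof -
        have "x \<in> (\<Union>i<?n. set (bs ! i))" using j S by blast
        then show ?thesis unfolding setr by simp
      qed
      then have "y \<in> {1..length \<rho>}" using y by simp
      then obtain k where k: "k < ?n" "y \<in> set (bs ! k)" unfolding setr[symmetric] by blast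
      have jn: "j < ?n" using j S by blast
      have "\<not> \<pi> ! j < \<pi> ! k" using sep[OF jn k(1) _ j(2) k(2)] y by linarith
      then have "\<pi> ! k < \<pi> ! j \<or> \<pi> ! k = \<pi> ! j" by linarith
      then have "k \<in> S"
      proof
        assume "\<pi> ! k < \<pi> ! j"
        then show ?thesis by (rule down[OF j(1) k(1)])
      next
        assume "\<pi> ! k = \<pi> ! j"
        then show ?thesis using dp k(1) jn j(1) by (simp add: nth_eq_iff_index_eq)
      qed
      then show "y \<in> ?A" using k(2) by (rule UN_I)
    qed
    moreover have "card ?A = (\<Sum>j\<in>S. card (set (bs ! j)))"
    proof (rule card_UN_disjoint)
      show "finite S" using S finite_subset by blast
      show "\<forall>i\<in>S. \<forall>j\<in>S. i \<noteq> j \<longrightarrow> set (bs ! i) \<inter> set (bs ! j) = {}" using S disj by blast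
    qed simp
    moreover have "\<dots> = (\<Sum>j\<in>S. length (\<sigma>s ! j))"
      using S ll db by (intro sum.cong) (auto simp: distinct_card)
    ultimately show ?thesis by simp
  qed
  have "bs = map (\<lambda>i. map (\<lambda>x. ?o i + x) (\<sigma>s ! i)) [0..<?n]"
  proof (rule nth_equalityI)
    show "length bs = length (map (\<lambda>i. map (\<lambda>x. ?o i + x) (\<sigma>s ! i)) [0..<?n])" using lb by simp
    fix i assume "i < length bs"
    then have i: "i < ?n" using lb by simp
    let ?S = "{j. j < ?n \<and> \<pi> ! j < \<pi> ! i}"
    let ?b = "map (\<lambda>x. ?o i + x) (\<sigma>s ! i)"
    have pi: "is_perm (\<sigma>s ! i)" using i len ps by simp
    have 1: "(\<Union>j\<in>?S. set (bs ! j)) = {1..?o i}"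
      unfolding inflation_shift_def by (rule seg) auto
    have "(\<Union>j\<in>insert i ?S. set (bs ! j)) = {1..\<Sum>j\<in>insert i ?S. length (\<sigma>s ! j)}"
    proof (rule seg)
      fix j k assume "j \<in> insert i ?S" "k < ?n" "\<pi> ! k < \<pi> ! j"
      then show "k \<in> insert i ?S" by auto
    qed (use i in auto)
    then have 2: "set (bs ! i) \<union> {1..?o i} = {1..length (\<sigma>s ! i) + ?o i}"
      
      using 1 by (simp add: inflation_shift_def)
    have "set (bs ! i) \<inter> set (bs ! j) = {}" if "j \<in> ?S" for j
      using that by (intro disj[OF i]) auto
    then have "set (bs ! i) \<inter> (\<Union>j\<in>?S. set (bs ! j)) = {}" by blast
    then have "set (bs ! i) \<inter> {1..?o i} = {}" unfolding 1 .
    then have "set (bs ! i) = {1..length (\<sigma>s ! i) + ?o i} - {1..?o i}" using 2 by blast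
    also have "\<dots> = (\<lambda>x. ?o i + x) ` {1..length (\<sigma>s ! i)}" by (auto simp: image_add_atLeastAtMost)
    also have "\<dots> = set ?b" using pi by (simp add: is_perm_def)
    finally have "set (bs ! i) = set ?b" .
    moreover have "order_iso (bs ! i) ?b" using iso[OF i] by (simp add: order_iso_def)
    moreover have "distinct ?b" using pi by (simp add: is_perm_def distinct_map)
    ultimately have "bs ! i = ?b" using db[OF i] by (intro order_iso_same_set)
    then show "bs ! i = map (\<lambda>i. map (\<lambda>x. ?o i + x) (\<sigma>s ! i)) [0..<?n] ! i" using i by simp
  qed
  then show "\<rho> = inflation \<pi> \<sigma>s" unfolding rho inflation_def by simp
qed

end

lemma is_perm_lr_inflation:
  assumes "is_perm \<pi>" "length \<sigma>s = card (lr_minima \<pi>)" "\<forall>\<sigma>\<in>set \<sigma>s. is_perm \<sigma>"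
  shows "is_perm (lr_inflation \<pi> \<sigma>s)"
  unfolding lr_inflation_def
proof (rule inflation_is_inflation(1)[OF assms(1)])
  have "is_perm (\<sigma>s ! card {j \<in> lr_minima \<pi>. j < i})" if "i \<in> lr_minima \<pi>" for i
  proof -
    have "finite (lr_minima \<pi>)" by (simp add: lr_minima_def)
    moreover have "{j \<in> lr_minima \<pi>. j < i} \<subset> lr_minima \<pi>" using that by auto
    ultimately have "card {j \<in> lr_minima \<pi>. j < i} < length \<sigma>s"
      unfolding assms(2) by (rule psubset_card_mono)
    then show ?thesis using assms(3) by simp
  qed
  moreover have "is_perm [1]" by (auto simp: is_perm_def)
  ultimately show "\<forall>\<sigma>\<in>set (map (\<lambda>i. if i \<in> lr_minima \<pi>
      then \<sigma>s ! card {j \<in> lr_minima \<pi>. j < i} else [1]) [0..<length \<pi>]). is_perm \<sigma>"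
    by auto
qed simp

lemma lr_closure_least:
  assumes "perm_class D" "C \<subseteq> D" "lr_inflation_closed D"
  shows "lr_closure C \<subseteq> D"
  using assms by (auto simp: lr_closure_def)

lemma lr_closure_superset: "C \<subseteq> lr_closure C"
  by (auto simp: lr_closure_def)

lemma lr_closure_closed: "lr_inflation_closed (lr_closure C)"
  unfolding lr_inflation_closed_def lr_closure_def by blast

lemma perm_class_lr_closure:
  assumes "perm_class C"
  shows "perm_class (lr_closure C)"
proof -
  have "perm_class {\<pi>. is_perm \<pi>}" by (simp add: perm_class_def)
  moreover have "lr_inflation_closed {\<pi>. is_perm \<pi>}"
    using is_perm_lr_inflation by (auto simp: lr_inflation_closed_def)
  moreover have "C \<subseteq> {\<pi>. is_perm \<pi>}" using assms by (auto simp: perm_class_def)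
  ultimately have "lr_closure C \<subseteq> {\<pi>. is_perm \<pi>}" by (intro lr_closure_least)
  then show ?thesis unfolding perm_class_def lr_closure_def by blast
qed

lemma lr_merge_commute: "A \<odot>\<^sub>L\<^sub>R B = B \<odot>\<^sub>L\<^sub>R A"
proof -
  have "is_lr_merge \<pi> \<tau> \<sigma> \<Longrightarrow> is_lr_merge \<pi> \<sigma> \<tau>" for \<pi> \<tau> \<sigma>
    unfolding is_lr_merge_def by (metis Int_commute Un_commute)
  then show ?thesis unfolding lr_merge_def by blast
qed

end

theory Submission imports Defs "HOL-Library.Product_Lexorder" begin

text \<open>
  Write \<open>K\<close> for the set of LR-merges of \<open>D\<^sup>L\<^sup>R\<close> with \<open>E\<^sup>L\<^sup>R\<close>; it contains \<open>C\<close>. The first idea is that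
  \<open>K\<close> is closed under LR-inflations (\<open>lr_inflation_closed_lr_merge\<close>). An LR-merge amounts to a
  colouring of the elements that are not LR-minima, red or blue, such that the red elements with
  the LR-minima form an element of \<open>D\<^sup>L\<^sup>R\<close> and the blue ones with the LR-minima an element of
  \<open>E\<^sup>L\<^sup>R\<close>. The LR-minima of an LR-inflation are exactly the LR-minima of the blocks that replace
  LR-minima. Hence colourings of \<open>\<pi>\<close> and of the blocks combine to a colouring of the inflation, and
  its red part with the LR-minima is again an LR-inflation: the red part of \<open>\<pi>\<close>, inflated by the red
  parts of the blocks.

  This does not yet bound \<open>C\<^sup>L\<^sup>R\<close>, because \<open>K\<close> need not be a permutation class: after a deletion, a
  red element may become an LR-minimum, and then it also belongs to the blue part. The second idea
  is to pass to the largest class inside \<open>K\<close>, which consists of the permutations all of whose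
  contained permutations lie in \<open>K\<close>. It is still closed under LR-inflations
  (\<open>lr_inflation_closed_hereditary_part\<close>). For a permutation contained in an LR-inflation of \<open>\<pi>\<close> is
  itself an LR-inflation, of the restriction of \<open>\<pi>\<close> to the elements whose blocks are still non-empty:
  an LR-minimum of the restriction either was an LR-minimum of \<open>\<pi>\<close>, and is inflated by a part of the
  old block, or it was not, and is inflated by a single point. The class \<open>C\<close>, being contained in
  \<open>K\<close>, is contained in this largest class; by minimality so is \<open>C\<^sup>L\<^sup>R\<close>.

  All these arguments restrict and combine sets of positions, so permutations are handled as
  patterns \<open>pattern v A\<close> of an injective function \<open>v\<close> on a finite linearly ordered index set \<open>A\<close>.
  Restriction passes to a subset of \<open>A\<close>, and inflation passes to the lexicographically ordered
  disjoint sum \<open>Sigma A B\<close>, with no renumbering of positions or values.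
\<close>

section \<open>Patterns of functions on finite index sets\<close>

text \<open>
  The permutation order-isomorphic to the values of \<open>v\<close> listed in the order of their indices: each
  value is replaced by its rank.
\<close>

definition pattern :: "('a::linorder \<Rightarrow> 'b::linorder) \<Rightarrow> 'a set \<Rightarrow> perm" where
  "pattern v A = map (\<lambda>a. card {b \<in> A. v b \<le> v a}) (sorted_list_of_set A)"

lemma length_pattern [simp]: "length (pattern v A) = card A"
  by (simp add: pattern_def)

lemma rank_less_iff:
  fixes v :: "'a \<Rightarrow> 'b::linorder"
  assumes "finite A" "a \<in> A" "b \<in> A"
  shows "card {c \<in> A. v c \<le> v a} < card {c \<in> A. v c \<le> v b} \<longleftrightarrow> v a < v b"
proof
  assume "v a < v b"
  then have "{c \<in> A. v c \<le> v a} \<subset> {c \<in> A. v c \<le> v b}" using assms(3) by force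
  then show "card {c \<in> A. v c \<le> v a} < card {c \<in> A. v c \<le> v b}"
    using assms(1) by (intro psubset_card_mono) auto
next
  assume less: "card {c \<in> A. v c \<le> v a} < card {c \<in> A. v c \<le> v b}"
  show "v a < v b"
  proof (rule ccontr)
    assume "\<not> v a < v b"
    then have "{c \<in> A. v c \<le> v b} \<subseteq> {c \<in> A. v c \<le> v a}" by auto
    then have "card {c \<in> A. v c \<le> v b} \<le> card {c \<in> A. v c \<le> v a}"
      using assms(1) by (intro card_mono) auto
    then show False using less by linarith
  qed
qed

lemma pattern_nth_less_iff:
  assumes "finite A" "i < card A" "j < card A"
  shows "pattern v A ! i < pattern v A ! j \<longleftrightarrow>
    v (sorted_list_of_set A ! i) < v (sorted_list_of_set A ! j)"
proof -
  have "sorted_list_of_set A ! i \<in> A" "sorted_list_of_set A ! j \<in> A"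
    using assms nth_mem[of _ "sorted_list_of_set A"] by auto
  then show ?thesis using assms by (simp add: pattern_def rank_less_iff)
qed

lemma is_perm_pattern:
  assumes "finite A" "A \<noteq> {}" "inj_on v A"
  shows "is_perm (pattern v A)"
proof -
  let ?r = "\<lambda>a. card {b \<in> A. v b \<le> v a}"
  have inj: "inj_on ?r A"
  proof (rule inj_onI)
    fix a b assume ab: "a \<in> A" "b \<in> A" "?r a = ?r b"
    then have "\<not> v a < v b" "\<not> v b < v a"
      using rank_less_iff[OF assms(1), of a b v] rank_less_iff[OF assms(1), of b a v] by auto
    then have "v a = v b" by simp
    then show "a = b" using assms(3) ab(1,2) by (simp add: inj_on_def)
  qed
  have "?r a \<in> {1..card A}" if "a \<in> A" for a
  proof -
    have "{b \<in> A. v b \<le> v a} \<noteq> {}" using that by auto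
    then have "?r a > 0" using assms(1) by (simp add: card_gt_0_iff)
    moreover have "?r a \<le> card A" using assms(1) by (intro card_mono) auto
    ultimately show ?thesis by simp
  qed
  then have "?r ` A = {1..card A}"
    using card_image[OF inj] by (intro card_subset_eq) auto
  moreover have "card A \<ge> 1" using assms(1,2) by (simp add: Suc_le_eq card_gt_0_iff)
  ultimately show ?thesis using assms(1) inj by (simp add: is_perm_def distinct_map pattern_def)
qed

lemma order_iso_perm_unique:
  assumes "order_iso xs \<sigma>" "order_iso xs \<tau>" "is_perm \<sigma>" "is_perm \<tau>"
  shows "\<sigma> = \<tau>"
proof (rule order_iso_same_set)
  show "order_iso \<sigma> \<tau>" using assms(1,2) by (simp add: order_iso_def)
  show "set \<sigma> = set \<tau>" using assms by (simp add: order_iso_def is_perm_def)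
qed (use assms in \<open>simp_all add: is_perm_def\<close>)

lemma perm_indices_nonempty: "is_perm \<pi> \<Longrightarrow> {..<length \<pi>} \<noteq> {}"
  by (auto simp: is_perm_def lessThan_empty_iff)

lemma perm_inj_on: "is_perm \<pi> \<Longrightarrow> inj_on ((!) \<pi>) {..<length \<pi>}"
  by (auto simp: is_perm_def inj_on_def nth_eq_iff_index_eq)

lemma pattern_perm_id:
  assumes "is_perm \<pi>"
  shows "pattern ((!) \<pi>) {..<length \<pi>} = \<pi>"
proof (rule order_iso_perm_unique)
  show "is_perm (pattern ((!) \<pi>) {..<length \<pi>})"
    using assms by (intro is_perm_pattern perm_indices_nonempty perm_inj_on) simp_all
  have "sorted_list_of_set {..<length \<pi>} = [0..<length \<pi>]"
    by (simp add: lessThan_atLeast0)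
  then show "order_iso \<pi> (pattern ((!) \<pi>) {..<length \<pi>})"
    by (simp add: order_iso_def pattern_nth_less_iff)
qed (use assms in \<open>simp_all add: order_iso_def\<close>)

lemma pattern_singleton: "is_singleton A \<Longrightarrow> pattern v A = [1]"
  by (auto simp: is_singleton_def pattern_def Collect_conv_if)

lemma bij_betw_sorted_nth:
  "finite A \<Longrightarrow> bij_betw ((!) (sorted_list_of_set A)) {..<card A} A"
  by (rule bij_betw_nth) auto

text \<open>
  A set \<open>I\<close> of positions in \<open>pattern v A\<close> corresponds to the set of indices enumerated at these
  positions. This translates subsequences into subsets of the index set.
\<close>

lemma order_iso_nths_pattern:
  assumes "finite A"
  shows "order_iso (nths (pattern v A) I)
    (pattern v ((!) (sorted_list_of_set A) ` (I \<inter> {..<card A})))"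
    (is "order_iso _ (pattern v ?B)")
proof -
  let ?xs = "sorted_list_of_set A"
  have sub: "?B \<subseteq> A" using bij_betw_sorted_nth[OF assms] by (auto simp: bij_betw_def)
  then have fin: "finite ?B" using assms finite_subset by blast
  have "set (nths ?xs I) = ?B" using assms by (auto simp: set_nths)
  moreover have "sorted (nths ?xs I)" "distinct (nths ?xs I)"
    by (simp_all add: sorted_nths distinct_nthsI)
  ultimately have l: "sorted_list_of_set ?B = nths ?xs I"
    by (metis sorted_list_of_set.idem_if_sorted_distinct)
  have n: "nths (pattern v A) I = map (\<lambda>a. card {b \<in> A. v b \<le> v a}) (sorted_list_of_set ?B)"
    by (simp add: pattern_def nths_map l)
  have mem: "sorted_list_of_set ?B ! i \<in> A" if "i < card ?B" for i
    using that sub fin nth_mem[of i "sorted_list_of_set ?B"] by auto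
  show ?thesis
    unfolding order_iso_def n using assms fin
    by (auto simp: pattern_nth_less_iff rank_less_iff mem)
qed

lemma contains_pattern_iff:
  assumes "finite A" "inj_on v A" "is_perm \<sigma>"
  shows "contains_perm (pattern v A) \<sigma> \<longleftrightarrow> (\<exists>B. B \<subseteq> A \<and> B \<noteq> {} \<and> \<sigma> = pattern v B)"
proof
  let ?e = "(!) (sorted_list_of_set A)"
  have bij: "bij_betw ?e {..<card A} A" by (rule bij_betw_sorted_nth[OF assms(1)])
  {
    assume "contains_perm (pattern v A) \<sigma>"
    then obtain I where I: "order_iso (nths (pattern v A) I) \<sigma>"
      by (auto simp: contains_perm_def)
    let ?B = "?e ` (I \<inter> {..<card A})"
    have iso: "order_iso (nths (pattern v A) I) (pattern v ?B)"
      by (rule order_iso_nths_pattern[OF assms(1)])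
    have sub: "?B \<subseteq> A" using bij by (auto simp: bij_betw_def)
    have "length \<sigma> = card ?B" using I iso by (simp add: order_iso_def)
    then have ne: "?B \<noteq> {}" using assms(3) by (auto simp: is_perm_def)
    have "is_perm (pattern v ?B)"
      using sub ne assms(1,2) by (metis finite_subset inj_on_subset is_perm_pattern)
    then have "\<sigma> = pattern v ?B" using order_iso_perm_unique[OF I iso assms(3)] by simp
    then show "\<exists>B. B \<subseteq> A \<and> B \<noteq> {} \<and> \<sigma> = pattern v B" using sub ne by blast
  }
  assume "\<exists>B. B \<subseteq> A \<and> B \<noteq> {} \<and> \<sigma> = pattern v B"
  then obtain B where B: "B \<subseteq> A" "\<sigma> = pattern v B" by blast
  have "?e ` ({i. ?e i \<in> B} \<inter> {..<card A}) = B"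
    using B(1) bij by (auto simp: bij_betw_def)
  then have "order_iso (nths (pattern v A) {i. ?e i \<in> B}) \<sigma>"
    using order_iso_nths_pattern[OF assms(1), of v "{i. ?e i \<in> B}"] B(2) by simp
  then show "contains_perm (pattern v A) \<sigma>" by (auto simp: contains_perm_def)
qed

section \<open>LR-minima and LR-merges of patterns\<close>

definition lr_min_on :: "('a::linorder \<Rightarrow> 'b::linorder) \<Rightarrow> 'a set \<Rightarrow> 'a set" where
  "lr_min_on v A = {a \<in> A. \<forall>b\<in>A. b < a \<longrightarrow> v a < v b}"

lemma lr_min_on_subset: "lr_min_on v A \<subseteq> A"
  by (auto simp: lr_min_on_def)

text \<open>
  The converse inclusion fails: deleting an LR-minimum can turn other elements into LR-minima.
\<close>

lemma lr_min_on_antimono: "B \<subseteq> A \<Longrightarrow> lr_min_on v A \<inter> B \<subseteq> lr_min_on v B"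
  by (auto simp: lr_min_on_def)

lemma lr_minima_eq: "lr_minima \<pi> = lr_min_on ((!) \<pi>) {..<length \<pi>}"
  by (auto simp: lr_minima_def lr_min_on_def)

lemma sorted_list_of_set_nth_less_iff:
  assumes "finite A" "i < card A" "j < card A"
  shows "sorted_list_of_set A ! i < sorted_list_of_set A ! j \<longleftrightarrow> i < j"
  using assms strict_sorted_list_of_set[of A]
  by (metis length_sorted_list_of_set linorder_neqE_nat order_less_asym order_less_irrefl
      sorted_wrt_nth_less)

lemma lr_minima_pattern:
  assumes "finite A"
  shows "lr_minima (pattern v A) =
    {i. i < card A \<and> sorted_list_of_set A ! i \<in> lr_min_on v A}"
proof -
  let ?e = "(!) (sorted_list_of_set A)"
  have A: "A = ?e ` {..<card A}" using bij_betw_sorted_nth[OF assms] by (simp add: bij_betw_def)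
  have "?e i \<in> lr_min_on v A \<longleftrightarrow> (\<forall>j<i. pattern v A ! i < pattern v A ! j)"
    if i: "i < card A" for i
  proof -
    have "?e i \<in> lr_min_on v A \<longleftrightarrow> (\<forall>b\<in>A. b < ?e i \<longrightarrow> v (?e i) < v b)"
      using i A by (auto simp: lr_min_on_def)
    also have "\<dots> \<longleftrightarrow> (\<forall>j<card A. ?e j < ?e i \<longrightarrow> v (?e i) < v (?e j))"
      by (subst (1) A) auto
    also have "\<dots> \<longleftrightarrow> (\<forall>j<i. v (?e i) < v (?e j))"
      using i by (auto simp: sorted_list_of_set_nth_less_iff[OF assms])
    also have "\<dots> \<longleftrightarrow> (\<forall>j<i. pattern v A ! i < pattern v A ! j)"
      using i by (auto simp: pattern_nth_less_iff[OF assms])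
    finally show ?thesis .
  qed
  then show ?thesis by (auto simp: lr_minima_def)
qed

text \<open>The smallest of the elements up to \<open>b\<close> is an LR-minimum.\<close>

lemma lr_min_on_below:
  assumes "finite A" "inj_on v A" "b \<in> A" "b \<notin> lr_min_on v A"
  shows "\<exists>m\<in>lr_min_on v A. m < b \<and> v m < v b"
proof -
  let ?L = "{c \<in> A. c \<le> b}"
  have "finite (v ` ?L)" "v ` ?L \<noteq> {}" using assms(1,3) by auto
  then have "Min (v ` ?L) \<in> v ` ?L" by (rule Min_in)
  then obtain m where m: "m \<in> A" "m \<le> b" "v m = Min (v ` ?L)" by auto
  have le: "v m \<le> v c" if "c \<in> A" "c \<le> b" for c
    using that assms(1) m(3) by simp
  have neq: "v m \<noteq> v c" if "c \<in> A" "c \<noteq> m" for c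
    using that m(1) assms(2) by (auto simp: inj_on_def)
  have min: "m \<in> lr_min_on v A"
    unfolding lr_min_on_def using m(1,2) le neq by (auto simp: order.strict_iff_order)
  moreover have "m \<noteq> b" using min assms(4) by auto
  ultimately show ?thesis using m(2) le[OF assms(3)] neq[OF assms(3)] by force
qed

text \<open>
  Every other element has an LR-minimum to its left and below it, so as long as the LR-minima stay,
  no deletion creates a new one. In particular the two parts of an LR-merge have the same
  LR-minima as the whole.
\<close>

lemma lr_min_on_between:
  assumes "finite A" "inj_on v A" "lr_min_on v A \<subseteq> B" "B \<subseteq> A"
  shows "lr_min_on v B = lr_min_on v A"
proof
  show "lr_min_on v A \<subseteq> lr_min_on v B" using lr_min_on_antimono[OF assms(4), of v] assms(3) by blast
  show "lr_min_on v B \<subseteq> lr_min_on v A"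
  proof
    fix b assume b: "b \<in> lr_min_on v B"
    show "b \<in> lr_min_on v A"
    proof (rule ccontr)
      assume "b \<notin> lr_min_on v A"
      moreover have "b \<in> A" using b assms(4) by (auto simp: lr_min_on_def)
      ultimately obtain m where "m \<in> lr_min_on v A" "m < b" "v m < v b"
        using lr_min_on_below[OF assms(1,2)] by blast
      then show False using b assms(3) by (auto simp: lr_min_on_def dest!: subsetD)
    qed
  qed
qed

text \<open>
  For sets of permutations, the parts \<open>\<tau>\<close> and \<open>\<sigma>\<close> of an LR-merge are determined by the
  colouring \<open>I\<close>, \<open>J\<close>, so that LR-merges can be described by subsets of the index set alone.
\<close>

lemma pattern_in_lr_merge_iff:
  assumes fin: "finite A" and ne: "A \<noteq> {}" and inj: "inj_on v A"
    and X: "\<forall>\<tau>\<in>X. is_perm \<tau>" and Y: "\<forall>\<tau>\<in>Y. is_perm \<tau>"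
  defines "M \<equiv> lr_min_on v A"
  shows "pattern v A \<in> X \<odot>\<^sub>L\<^sub>R Y \<longleftrightarrow>
    (\<exists>I J. I \<union> J = A - M \<and> I \<inter> J = {} \<and> pattern v (I \<union> M) \<in> X \<and> pattern v (J \<union> M) \<in> Y)"
proof
  let ?e = "(!) (sorted_list_of_set A)" and ?n = "card A" and ?\<pi> = "pattern v A"
  have bij: "bij_betw ?e {..<?n} A" by (rule bij_betw_sorted_nth[OF fin])
  have perm: "is_perm ?\<pi>" using is_perm_pattern[OF fin ne inj] .
  have mins: "lr_minima ?\<pi> = {i. i < ?n \<and> ?e i \<in> M}"
    unfolding M_def by (rule lr_minima_pattern[OF fin])
  have emins: "?e ` lr_minima ?\<pi> = M"
    unfolding mins using bij lr_min_on_subset[of v A] by (auto simp: bij_betw_def M_def)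
  have iso: "order_iso (nths ?\<pi> (I \<union> lr_minima ?\<pi>)) (pattern v (?e ` I \<union> M))"
    if "I \<subseteq> {..<?n}" for I
  proof -
    have "(I \<union> lr_minima ?\<pi>) \<inter> {..<?n} = I \<union> lr_minima ?\<pi>" using that mins by auto
    then show ?thesis
      using order_iso_nths_pattern[OF fin, of v "I \<union> lr_minima ?\<pi>"] by (simp add: image_Un emins)
  qed
  {
    assume "?\<pi> \<in> X \<odot>\<^sub>L\<^sub>R Y"
    then obtain \<tau> \<sigma> I J where t: "\<tau> \<in> X" "\<sigma> \<in> Y"
      and IJ: "I \<union> J = {..<?n} - lr_minima ?\<pi>" "I \<inter> J = {}"
      and i: "order_iso (nths ?\<pi> (I \<union> lr_minima ?\<pi>)) \<tau>"
      and j: "order_iso (nths ?\<pi> (J \<union> lr_minima ?\<pi>)) \<sigma>"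
      by (auto simp: lr_merge_def is_lr_merge_def)
    have sub: "I \<subseteq> {..<?n}" "J \<subseteq> {..<?n}" using IJ(1) by auto
    have eq: "\<rho> = pattern v (?e ` K \<union> M)"
      if K: "K \<subseteq> {..<?n}" and k: "order_iso (nths ?\<pi> (K \<union> lr_minima ?\<pi>)) \<rho>" and r: "is_perm \<rho>"
      for K \<rho>
    proof (rule order_iso_perm_unique[OF k iso[OF K] r])
      have "?e ` K \<union> M \<subseteq> A"
        using K bij lr_min_on_subset[of v A] by (auto simp: bij_betw_def M_def)
      moreover have "length \<rho> = card (?e ` K \<union> M)"
        using k iso[OF K] by (simp add: order_iso_def)
      moreover have "length \<rho> \<noteq> 0" using r by (auto simp: is_perm_def)
      ultimately show "is_perm (pattern v (?e ` K \<union> M))"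
        by (metis card.empty fin finite_subset inj inj_on_subset is_perm_pattern)
    qed
    have "?e ` I \<union> ?e ` J = A - M"
      unfolding image_Un[symmetric] IJ(1) mins using bij by (auto simp: bij_betw_def)
    moreover have "?e ` I \<inter> ?e ` J = {}"
      using bij sub IJ(2) by (metis bij_betw_def image_empty inj_on_image_Int)
    moreover have "pattern v (?e ` I \<union> M) \<in> X" "pattern v (?e ` J \<union> M) \<in> Y"
      using eq[OF sub(1) i] eq[OF sub(2) j] X Y t by metis+
    ultimately show "\<exists>I J. I \<union> J = A - M \<and> I \<inter> J = {} \<and>
      pattern v (I \<union> M) \<in> X \<and> pattern v (J \<union> M) \<in> Y" by blast
  }
  assume "\<exists>I J. I \<union> J = A - M \<and> I \<inter> J = {} \<and>
      pattern v (I \<union> M) \<in> X \<and> pattern v (J \<union> M) \<in> Y"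
  then obtain I J where IJ: "I \<union> J = A - M" "I \<inter> J = {}"
    and t: "pattern v (I \<union> M) \<in> X" "pattern v (J \<union> M) \<in> Y" by blast
  let ?f = "\<lambda>K. {i \<in> {..<?n}. ?e i \<in> K}"
  have "?e ` ?f K = K" if "K \<subseteq> A" for K using that bij by (auto simp: bij_betw_def)
  then have "?e ` ?f I = I" "?e ` ?f J = J" using IJ(1) by blast+
  moreover have "?f K \<subseteq> {..<?n}" for K by blast
  ultimately have "order_iso (nths ?\<pi> (?f I \<union> lr_minima ?\<pi>)) (pattern v (I \<union> M))"
    "order_iso (nths ?\<pi> (?f J \<union> lr_minima ?\<pi>)) (pattern v (J \<union> M))"
    using iso[of "?f I"] iso[of "?f J"] by metis+
  moreover have "?f I \<union> ?f J = {..<?n} - lr_minima ?\<pi>"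
  proof -
    have "?f I \<union> ?f J = ?f (A - M)" unfolding IJ(1)[symmetric] by blast
    also have "\<dots> = {..<?n} - lr_minima ?\<pi>" unfolding mins using bij by (auto simp: bij_betw_def)
    finally show ?thesis .
  qed
  moreover have "?f I \<inter> ?f J = {}" using IJ(2) by blast
  ultimately have "is_lr_merge ?\<pi> (pattern v (I \<union> M)) (pattern v (J \<union> M))"
    unfolding is_lr_merge_def length_pattern by blast
  then show "?\<pi> \<in> X \<odot>\<^sub>L\<^sub>R Y" using perm t by (auto simp: lr_merge_def)
qed

section \<open>Inflations of patterns\<close>

text \<open>
  The values of the inflation that replaces each point \<open>a\<close> by the points \<open>(a, b)\<close> of its block:
  pairs are ordered lexicographically, so points of different blocks compare as the replaced points
  do, and points of the block of \<open>a\<close> compare by \<open>w a\<close>.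
\<close>

definition infl_val :: "('a \<Rightarrow> 'b) \<Rightarrow> ('a \<Rightarrow> 'c \<Rightarrow> 'd) \<Rightarrow> 'a \<times> 'c \<Rightarrow> 'b \<times> 'd" where
  "infl_val v w = (\<lambda>(a, b). (v a, w a b))"

lemma inj_on_infl_val:
  assumes "inj_on v A" "\<And>a. a \<in> A \<Longrightarrow> inj_on (w a) (B a)"
  shows "inj_on (infl_val v w) (Sigma A B)"
proof (rule inj_onI)
  fix p q assume pq: "p \<in> Sigma A B" "q \<in> Sigma A B" and eq: "infl_val v w p = infl_val v w q"
  obtain a b c d where ab: "p = (a, b)" and cd: "q = (c, d)" by fastforce
  have "a = c" using pq eq assms(1) unfolding ab cd by (auto simp: inj_on_def infl_val_def)
  moreover from this have "b = d"
    using pq eq assms(2)[of a] unfolding ab cd by (auto simp: inj_on_def infl_val_def)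
  ultimately show "p = q" by (simp add: ab cd)
qed

lemma sorted_list_of_set_Sigma:
  fixes A :: "'a::linorder set" and B :: "'a \<Rightarrow> 'c::linorder set"
  assumes "finite A" "\<And>a. a \<in> A \<Longrightarrow> finite (B a)"
  shows "sorted_list_of_set (Sigma A B) =
    concat (map (\<lambda>a. map (Pair a) (sorted_list_of_set (B a))) (sorted_list_of_set A))"
proof -
  have sorted: "sorted_wrt (<) (concat (map (\<lambda>a. map (Pair a) (sorted_list_of_set (B a))) xs))"
    if "sorted_wrt (<) xs" for xs :: "'a list"
    using that
  proof (induction xs)
    case (Cons x xs)
    have "sorted_wrt (<) (map (Pair x) (sorted_list_of_set (B x)))"
      by (simp add: sorted_wrt_map strict_sorted_list_of_set)
    then show ?case using Cons by (auto simp: sorted_wrt_append)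
  qed simp
  let ?l = "concat (map (\<lambda>a. map (Pair a) (sorted_list_of_set (B a))) (sorted_list_of_set A))"
  have "sorted_wrt (<) ?l" by (rule sorted) (rule strict_sorted_list_of_set)
  moreover have "set ?l = Sigma A B" using assms by auto
  ultimately show ?thesis
    using sorted_list_of_set.idem_if_sorted_distinct[of ?l] by (simp add: strict_sorted_iff)
qed

text \<open>
  Both the positions \<open>(a, b)\<close> and the values are compared lexicographically, so the pattern on the
  disjoint sum splits into blocks as an inflation should, and an inflation is determined by this
  property (\<open>inflation_iff\<close>).
\<close>

lemma inflation_pattern:
  fixes v :: "'a::linorder \<Rightarrow> 'b::linorder" and w :: "'a \<Rightarrow> 'c::linorder \<Rightarrow> 'd::linorder"
  assumes fin: "finite A" and ne: "A \<noteq> {}" and inj: "inj_on v A"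
    and B: "\<And>a. a \<in> A \<Longrightarrow> finite (B a) \<and> B a \<noteq> {} \<and> inj_on (w a) (B a)"
  shows "inflation (pattern v A) (map (\<lambda>a. pattern (w a) (B a)) (sorted_list_of_set A)) =
    pattern (infl_val v w) (Sigma A B)"
proof -
  let ?S = "Sigma A B" and ?u = "infl_val v w" and ?xs = "sorted_list_of_set A"
  let ?\<sigma>s = "map (\<lambda>a. pattern (w a) (B a)) ?xs"
  let ?r = "\<lambda>p. card {q \<in> ?S. ?u q \<le> ?u p}"
  let ?b = "\<lambda>a. map (\<lambda>b. ?r (a, b)) (sorted_list_of_set (B a))"
  have finS: "finite ?S" using fin B by blast
  have xs: "?xs ! i \<in> A" if "i < card A" for i
    using that fin nth_mem[of i ?xs] by auto
  have perm: "is_perm (pattern ?u ?S)"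
  proof (rule is_perm_pattern[OF finS])
    show "?S \<noteq> {}" using ne B by blast
    show "inj_on ?u ?S" using inj B by (intro inj_on_infl_val) blast+
  qed
  have concat: "pattern ?u ?S = concat (map ?b ?xs)"
    unfolding pattern_def using fin B
    by (subst sorted_list_of_set_Sigma) (auto simp: map_concat comp_def)
  have "inflation_blocks (pattern v A) ?\<sigma>s (pattern ?u ?S) (map ?b ?xs)"
    unfolding inflation_blocks_def length_pattern
  proof (intro conjI allI impI ballI)
    show "pattern ?u ?S = concat (map ?b ?xs)" by (rule concat)
    show "length (map ?b ?xs) = card A" by simp
  next
    fix i assume i: "i < card A"
    have a: "?xs ! i \<in> A" by (rule xs[OF i])
    have fB: "finite (B (?xs ! i))" using B[OF a] by blast
    have "sorted_list_of_set (B (?xs ! i)) ! k \<in> B (?xs ! i)" if "k < card (B (?xs ! i))" for k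
      using that fB nth_mem[of k "sorted_list_of_set (B (?xs ! i))"] by auto
    moreover have "?r (?xs ! i, b) < ?r (?xs ! i, c) \<longleftrightarrow> w (?xs ! i) b < w (?xs ! i) c"
      if "b \<in> B (?xs ! i)" "c \<in> B (?xs ! i)" for b c
      using a that by (subst rank_less_iff[OF finS]) (auto simp: infl_val_def)
    ultimately show "order_iso (map ?b ?xs ! i) (?\<sigma>s ! i)"
      using i fB by (simp add: order_iso_def pattern_nth_less_iff)
  next
    fix i j x y
    assume ij: "i < card A" "j < card A" and less: "pattern v A ! i < pattern v A ! j"
      and x: "x \<in> set (map ?b ?xs ! i)" and y: "y \<in> set (map ?b ?xs ! j)"
    have a: "?xs ! i \<in> A" "?xs ! j \<in> A" using xs ij by auto
    have fB: "finite (B (?xs ! i))" "finite (B (?xs ! j))" using B a by blast+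
    obtain b where b: "b \<in> B (?xs ! i)" "x = ?r (?xs ! i, b)" using x ij fB by auto
    obtain c where c: "c \<in> B (?xs ! j)" "y = ?r (?xs ! j, c)" using y ij fB by auto
    have "v (?xs ! i) < v (?xs ! j)" using less ij by (simp add: pattern_nth_less_iff[OF fin])
    then have "?u (?xs ! i, b) < ?u (?xs ! j, c)" by (simp add: infl_val_def)
    then show "x < y" unfolding b(2) c(2)
      using a b(1) c(1) by (subst rank_less_iff[OF finS]) auto
  qed
  then have "pattern ?u ?S = inflation (pattern v A) ?\<sigma>s"
    using perm B fin by (subst inflation_iff) (auto intro!: is_perm_pattern ne inj)
  then show ?thesis ..
qed

lemma sorted_list_of_set_nth_card:
  assumes "finite M" "a \<in> M"
  shows "sorted_list_of_set M ! card {m \<in> M. m < a} = a" "card {m \<in> M. m < a} < card M"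
proof -
  let ?e = "(!) (sorted_list_of_set M)"
  have bij: "bij_betw ?e {..<card M} M" by (rule bij_betw_sorted_nth[OF assms(1)])
  obtain k where k: "k < card M" "a = ?e k" using bij assms(2) by (auto simp: bij_betw_def)
  have "{m \<in> M. m < a} = ?e ` {j. j < card M \<and> ?e j < ?e k}"
    using bij k by (auto simp: bij_betw_def)
  also have "{j. j < card M \<and> ?e j < ?e k} = {..<k}"
    using k by (auto simp: sorted_list_of_set_nth_less_iff[OF assms(1)])
  finally have "card {m \<in> M. m < a} = card (?e ` {..<k})" by simp
  also have "\<dots> = k"
    using bij k by (subst card_image) (auto simp: bij_betw_def elim!: inj_on_subset)
  finally show "?e (card {m \<in> M. m < a}) = a" "card {m \<in> M. m < a} < card M" using k by auto
qed

text \<open>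
  An inflation is an LR-inflation as soon as all blocks at the other elements are single points,
  because the only pattern on a single point is \<open>[1]\<close>.
\<close>

lemma lr_inflation_pattern:
  fixes v :: "'a::linorder \<Rightarrow> 'b::linorder" and w :: "'a \<Rightarrow> 'c::linorder \<Rightarrow> 'd::linorder"
  assumes fin: "finite A" and ne: "A \<noteq> {}" and inj: "inj_on v A"
    and B: "\<And>a. a \<in> A \<Longrightarrow> finite (B a) \<and> B a \<noteq> {} \<and> inj_on (w a) (B a)"
    and sing: "\<And>a. a \<in> A - lr_min_on v A \<Longrightarrow> is_singleton (B a)"
  shows "lr_inflation (pattern v A)
      (map (\<lambda>a. pattern (w a) (B a)) (sorted_list_of_set (lr_min_on v A))) =
    pattern (infl_val v w) (Sigma A B)"
proof -
  let ?M = "lr_min_on v A" and ?e = "(!) (sorted_list_of_set A)"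
  let ?f = "\<lambda>a. pattern (w a) (B a)" and ?\<pi> = "pattern v A"
  have bij: "bij_betw ?e {..<card A} A" by (rule bij_betw_sorted_nth[OF fin])
  have finM: "finite ?M" using fin lr_min_on_subset finite_subset by blast
  have mins: "lr_minima ?\<pi> = {i. i < card A \<and> ?e i \<in> ?M}" by (rule lr_minima_pattern[OF fin])
  have block: "(if i \<in> lr_minima ?\<pi>
      then map ?f (sorted_list_of_set ?M) ! card {j \<in> lr_minima ?\<pi>. j < i} else [1]) = ?f (?e i)"
    if i: "i < card A" for i
  proof (cases "?e i \<in> ?M")
    case True
    have "{m \<in> ?M. m < ?e i} = ?e ` {j \<in> lr_minima ?\<pi>. j < i}"
    proof -
      have "{m \<in> ?M. m < ?e i} = ?e ` {j \<in> {..<card A}. ?e j \<in> ?M \<and> ?e j < ?e i}"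
        using bij lr_min_on_subset[of v A] by (auto simp: bij_betw_def)
      also have "{j \<in> {..<card A}. ?e j \<in> ?M \<and> ?e j < ?e i} = {j \<in> lr_minima ?\<pi>. j < i}"
        unfolding mins using i by (auto simp: sorted_list_of_set_nth_less_iff[OF fin])
      finally show ?thesis .
    qed
    then have "card {m \<in> ?M. m < ?e i} = card {j \<in> lr_minima ?\<pi>. j < i}"
      using bij mins by (simp add: card_image bij_betw_def inj_on_def)
    then show ?thesis
      using True i mins sorted_list_of_set_nth_card[OF finM True] by simp
  next
    case False
    then have "?e i \<in> A - ?M" using i bij by (auto simp: bij_betw_def)
    then have "?f (?e i) = [1]" using sing pattern_singleton by blast
    then show ?thesis using False mins by simp
  qed
  have "map (\<lambda>i. if i \<in> lr_minima ?\<pi>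
      then map ?f (sorted_list_of_set ?M) ! card {j \<in> lr_minima ?\<pi>. j < i} else [1]) [0..<card A]
    = map (\<lambda>i. ?f (?e i)) [0..<card A]"
    by (rule map_cong[OF refl], rule block) simp
  also have "\<dots> = map ?f (sorted_list_of_set A)"
    by (rule nth_equalityI) simp_all
  finally show ?thesis
    unfolding lr_inflation_def length_pattern using inflation_pattern[OF fin ne inj B] by simp
qed

text \<open>
  The form in which closure under LR-inflations is applied below: membership of the inflation
  follows from that of \<open>pattern v A\<close> and of the blocks, without an enumeration of the LR-minima.
\<close>

lemma lr_inflation_closed_pattern:
  fixes v :: "'a::linorder \<Rightarrow> 'b::linorder" and w :: "'a \<Rightarrow> 'c::linorder \<Rightarrow> 'd::linorder"
  assumes X: "lr_inflation_closed X"
    and fin: "finite A" and ne: "A \<noteq> {}" and inj: "inj_on v A"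
    and B: "\<And>a. a \<in> A \<Longrightarrow> finite (B a) \<and> B a \<noteq> {} \<and> inj_on (w a) (B a)"
    and sing: "\<And>a. a \<in> A - lr_min_on v A \<Longrightarrow> is_singleton (B a)"
    and base: "pattern v A \<in> X"
    and blocks: "\<And>a. a \<in> lr_min_on v A \<Longrightarrow> pattern (w a) (B a) \<in> X"
  shows "pattern (infl_val v w) (Sigma A B) \<in> X"
proof -
  let ?M = "lr_min_on v A" and ?e = "(!) (sorted_list_of_set A)"
  let ?\<sigma>s = "map (\<lambda>a. pattern (w a) (B a)) (sorted_list_of_set ?M)"
  have finM: "finite ?M" using fin lr_min_on_subset finite_subset by blast
  have bij: "bij_betw ?e {..<card A} A" by (rule bij_betw_sorted_nth[OF fin])
  have "?e ` lr_minima (pattern v A) = ?M"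
    unfolding lr_minima_pattern[OF fin] using bij lr_min_on_subset[of v A]
    by (auto simp: bij_betw_def)
  moreover have "inj_on ?e (lr_minima (pattern v A))"
    unfolding lr_minima_pattern[OF fin] using bij by (auto simp: bij_betw_def inj_on_def)
  ultimately have "length ?\<sigma>s = card (lr_minima (pattern v A))"
    by (metis card_image length_map length_sorted_list_of_set)
  moreover have "set ?\<sigma>s \<subseteq> X" using blocks finM by auto
  ultimately have "lr_inflation (pattern v A) ?\<sigma>s \<in> X"
    using X base unfolding lr_inflation_closed_def by blast
  moreover have "lr_inflation (pattern v A) ?\<sigma>s = pattern (infl_val v w) (Sigma A B)"
    using fin ne inj B sing by (rule lr_inflation_pattern)
  ultimately show ?thesis by simp
qed

text \<open>
  Conversely, every LR-inflation is of this form, with the positions of each inflating permutation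
  as the indices of its block.
\<close>

lemma lr_inflation_as_pattern:
  assumes p: "is_perm \<pi>" and len: "length \<sigma>s = card (lr_minima \<pi>)"
    and X: "set \<sigma>s \<subseteq> X" "\<forall>\<sigma>\<in>X. is_perm \<sigma>"
  obtains B w where
    "lr_inflation \<pi> \<sigma>s = pattern (infl_val ((!) \<pi>) w) (Sigma {..<length \<pi>} B)"
    "\<And>a::nat. a < length \<pi> \<Longrightarrow> finite (B a) \<and> B a \<noteq> {} \<and> inj_on (w a :: nat \<Rightarrow> nat) (B a)"
    "\<And>a. a < length \<pi> \<Longrightarrow> a \<notin> lr_minima \<pi> \<Longrightarrow> is_singleton (B a)"
    "\<And>a. a \<in> lr_minima \<pi> \<Longrightarrow> pattern (w a) (B a) \<in> X"
proof -
  let ?s = "\<lambda>i. if i \<in> lr_minima \<pi> then \<sigma>s ! card {j \<in> lr_minima \<pi>. j < i} else [1]"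
  let ?w = "\<lambda>i. (!) (?s i)" and ?B = "\<lambda>i. {..<length (?s i)}" and ?n = "length \<pi>"
  have fin: "finite (lr_minima \<pi>)" by (simp add: lr_minima_def)
  have sX: "?s i \<in> X" if "i \<in> lr_minima \<pi>" for i
    using that sorted_list_of_set_nth_card(2)[OF fin that] X(1) len by auto
  have perm: "is_perm (?s i)" for i
  proof (cases "i \<in> lr_minima \<pi>")
    case True
    then show ?thesis using sX[OF True] X(2) by blast
  qed (auto simp: is_perm_def)
  have sp: "pattern (?w i) (?B i) = ?s i" for i by (rule pattern_perm_id[OF perm])
  have B: "finite (?B i) \<and> ?B i \<noteq> {} \<and> inj_on (?w i) (?B i)" for i
    using perm_indices_nonempty[OF perm] perm_inj_on[OF perm] by simp
  have "inflation (pattern ((!) \<pi>) {..<?n})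
      (map (\<lambda>i. pattern (?w i) (?B i)) (sorted_list_of_set {..<?n})) =
    pattern (infl_val ((!) \<pi>) ?w) (Sigma {..<?n} ?B)"
  proof (rule inflation_pattern)
    show "{..<?n} \<noteq> {}" by (rule perm_indices_nonempty[OF p])
    show "inj_on ((!) \<pi>) {..<?n}" by (rule perm_inj_on[OF p])
  qed (use B in simp_all)
  then have "lr_inflation \<pi> \<sigma>s = pattern (infl_val ((!) \<pi>) ?w) (Sigma {..<?n} ?B)"
    unfolding lr_inflation_def sp pattern_perm_id[OF p]
    by (simp only: lessThan_atLeast0 sorted_list_of_set_range)
  moreover have "is_singleton (?B a)" if "a \<notin> lr_minima \<pi>" for a
    using that by (simp add: is_singleton_def lessThan_Suc)
  moreover have "pattern (?w a) (?B a) \<in> X" if "a \<in> lr_minima \<pi>" for a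
    unfolding sp using sX[OF that] .
  ultimately show ?thesis using B by (intro that) blast+
qed

text \<open>
  A point \<open>(a, b)\<close> lies below all points of an earlier block exactly if \<open>a\<close> lies below the point
  replaced by that block. Non-emptiness of the blocks is essential here: an earlier, smaller point
  prevents \<open>a\<close> from contributing LR-minima only if its block has a point.
\<close>

lemma lr_min_on_Sigma:
  fixes v :: "'a::linorder \<Rightarrow> 'b::linorder" and w :: "'a \<Rightarrow> 'c::linorder \<Rightarrow> 'd::linorder"
  assumes inj: "inj_on v A" and B: "\<And>a. a \<in> A \<Longrightarrow> B a \<noteq> {}"
  shows "lr_min_on (infl_val v w) (Sigma A B) =
    Sigma (lr_min_on v A) (\<lambda>a. lr_min_on (w a) (B a))"
proof (intro set_eqI iffI)
  fix p assume p: "p \<in> lr_min_on (infl_val v w) (Sigma A B)"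
  obtain a b where ab: "p = (a, b)" by (cases p)
  have mem: "a \<in> A" "b \<in> B a" using p ab by (auto simp: lr_min_on_def)
  have less: "infl_val v w (a, b) < infl_val v w (c, d)"
    if "c \<in> A" "d \<in> B c" "(c, d) < (a, b)" for c d
    using p that unfolding ab lr_min_on_def by blast
  have "v a < v c" if c: "c \<in> A" "c < a" for c
  proof -
    obtain d where "d \<in> B c" using B[OF c(1)] by blast
    then have "v a \<le> v c" using less[of c d] c by (auto simp: infl_val_def)
    moreover have "v a \<noteq> v c" using inj c mem(1) by (auto simp: inj_on_def)
    ultimately show ?thesis by simp
  qed
  moreover have "w a b < w a d" if "d \<in> B a" "d < b" for d
    using less[of a d] that mem(1) by (simp add: infl_val_def)
  ultimately show "p \<in> Sigma (lr_min_on v A) (\<lambda>a. lr_min_on (w a) (B a))"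
    using mem ab by (auto simp: lr_min_on_def)
next
  fix p assume "p \<in> Sigma (lr_min_on v A) (\<lambda>a. lr_min_on (w a) (B a))"
  then show "p \<in> lr_min_on (infl_val v w) (Sigma A B)"
    by (auto simp: lr_min_on_def infl_val_def)
qed

section \<open>LR-inflations of LR-merges\<close>

text \<open>
  The colouring of the inflation: a point in the block of an LR-minimum \<open>a\<close> keeps its colour from
  the block (\<open>P a\<close> or \<open>Q a\<close>), and the point replacing any other element keeps the colour of that
  element (\<open>I\<close> or \<open>J\<close>).
\<close>

lemma lr_inflation_closed_lr_merge:
  assumes X: "lr_inflation_closed X" "\<forall>\<tau>\<in>X. is_perm \<tau>"
    and Y: "lr_inflation_closed Y" "\<forall>\<tau>\<in>Y. is_perm \<tau>"
  shows "lr_inflation_closed (X \<odot>\<^sub>L\<^sub>R Y)"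
  unfolding lr_inflation_closed_def
proof (intro ballI allI impI)
  let ?K = "X \<odot>\<^sub>L\<^sub>R Y"
  fix \<pi> \<sigma>s assume K: "\<pi> \<in> ?K" and \<sigma>s: "length \<sigma>s = card (lr_minima \<pi>) \<and> set \<sigma>s \<subseteq> ?K"
  have perms: "\<forall>\<rho>\<in>?K. is_perm \<rho>" by (auto simp: lr_merge_def)
  have p: "is_perm \<pi>" using K perms by blast
  let ?A = "{..<length \<pi>}" and ?v = "(!) \<pi>"
  let ?M = "lr_min_on ?v ?A"
  have A: "finite ?A" "?A \<noteq> {}" "inj_on ?v ?A"
    using perm_indices_nonempty[OF p] perm_inj_on[OF p] by simp_all
  obtain B w where eq: "lr_inflation \<pi> \<sigma>s = pattern (infl_val ?v w) (Sigma ?A B)"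
    and B: "\<And>a. a \<in> ?A \<Longrightarrow> finite (B a) \<and> B a \<noteq> {} \<and> inj_on (w a :: nat \<Rightarrow> nat) (B a)"
    and sing: "\<And>a. a \<in> ?A - ?M \<Longrightarrow> is_singleton (B a)"
    and blocks: "\<And>a. a \<in> ?M \<Longrightarrow> pattern (w a) (B a) \<in> ?K"
    using lr_inflation_as_pattern[OF p _ _ perms, of \<sigma>s] \<sigma>s unfolding lr_minima_eq
    by (metis DiffD1 DiffD2 lessThan_iff)
  let ?S = "Sigma ?A B" and ?u = "infl_val ?v w" and ?N = "\<lambda>a. lr_min_on (w a) (B a)"
  have MA: "?M \<subseteq> ?A" by (rule lr_min_on_subset)
  have NB: "?N a \<subseteq> B a" for a by (rule lr_min_on_subset)
  have S: "finite ?S" "?S \<noteq> {}" "inj_on ?u ?S"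
    using A B by (auto intro!: inj_on_infl_val)
  have minS: "lr_min_on ?u ?S = Sigma ?M ?N" using A(3) B by (intro lr_min_on_Sigma) blast+
  obtain I J where IJ: "I \<union> J = ?A - ?M" "I \<inter> J = {}"
    and IX: "pattern ?v (I \<union> ?M) \<in> X" and JY: "pattern ?v (J \<union> ?M) \<in> Y"
    using K pattern_in_lr_merge_iff[OF A X(2) Y(2)] unfolding pattern_perm_id[OF p] by blast
  have "\<exists>P Q. P \<union> Q = B a - ?N a \<and> P \<inter> Q = {} \<and>
      pattern (w a) (P \<union> ?N a) \<in> X \<and> pattern (w a) (Q \<union> ?N a) \<in> Y" if "a \<in> ?M" for a
    using blocks[OF that] pattern_in_lr_merge_iff[OF _ _ _ X(2) Y(2), of "B a" "w a"] B MA that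
    by blast
  then obtain P Q where PQ: "\<And>a. a \<in> ?M \<Longrightarrow> P a \<union> Q a = B a - ?N a"
      "\<And>a. a \<in> ?M \<Longrightarrow> P a \<inter> Q a = {}"
    and PX: "\<And>a. a \<in> ?M \<Longrightarrow> pattern (w a) (P a \<union> ?N a) \<in> X"
    and QY: "\<And>a. a \<in> ?M \<Longrightarrow> pattern (w a) (Q a \<union> ?N a) \<in> Y"
    by metis
  \<comment> \<open>One colour class with all LR-minima is an LR-inflation of the corresponding part of \<open>\<pi>\<close>; this is
    applied to \<open>(X, I, P)\<close> and to \<open>(Y, J, Q)\<close>.\<close>
  have part: "pattern ?u (Sigma L B \<union> Sigma ?M R \<union> Sigma ?M ?N) \<in> Z"
    if Z: "lr_inflation_closed Z" "\<forall>\<tau>\<in>Z. is_perm \<tau>" and L: "L \<subseteq> ?A - ?M" "pattern ?v (L \<union> ?M) \<in> Z"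
      and R: "\<And>a. a \<in> ?M \<Longrightarrow> R a \<subseteq> B a" "\<And>a. a \<in> ?M \<Longrightarrow> pattern (w a) (R a \<union> ?N a) \<in> Z"
    for Z L R
  proof -
    let ?C = "\<lambda>a. if a \<in> ?M then R a \<union> ?N a else B a"
    have LA: "L \<union> ?M \<subseteq> ?A" using L(1) MA by blast
    have min: "lr_min_on ?v (L \<union> ?M) = ?M"
      using A LA by (intro lr_min_on_between) auto
    have "pattern ?u (Sigma (L \<union> ?M) ?C) \<in> Z"
    proof (rule lr_inflation_closed_pattern[OF Z(1)])
      show "finite (L \<union> ?M)" using LA finite_subset by blast
      have "is_perm (pattern ?v (L \<union> ?M))" using Z(2) L(2) by blast
      then show "L \<union> ?M \<noteq> {}" by (auto simp: is_perm_def)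
      show "inj_on ?v (L \<union> ?M)" using LA A(3) inj_on_subset by blast
      show "pattern ?v (L \<union> ?M) \<in> Z" by (rule L(2))
      show "pattern (w a) (?C a) \<in> Z" if "a \<in> lr_min_on ?v (L \<union> ?M)" for a
        using that R(2) min by simp
      show "is_singleton (?C a)" if "a \<in> L \<union> ?M - lr_min_on ?v (L \<union> ?M)" for a
        using that sing L(1) min by auto
      show "finite (?C a) \<and> ?C a \<noteq> {} \<and> inj_on (w a) (?C a)" if a: "a \<in> L \<union> ?M" for a
      proof (cases "a \<in> ?M")
        case True
        have "?C a \<subseteq> B a" using True R(1) NB by auto
        moreover have "is_perm (pattern (w a) (R a \<union> ?N a))" using Z(2) R(2)[OF True] by blast
        then have "?C a \<noteq> {}" using True by (auto simp: is_perm_def)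
        ultimately show ?thesis using B[of a] a LA by (meson finite_subset inj_on_subset subsetD)
      next
        case False
        then show ?thesis using B[of a] a LA by auto
      qed
    qed
    moreover have "Sigma (L \<union> ?M) ?C = Sigma L B \<union> Sigma ?M R \<union> Sigma ?M ?N"
      using L(1) by (auto split: if_splits)
    ultimately show ?thesis by simp
  qed
  have "(Sigma I B \<union> Sigma ?M P) \<union> (Sigma J B \<union> Sigma ?M Q) = ?S - Sigma ?M ?N"
  proof -
    have "(Sigma I B \<union> Sigma ?M P) \<union> (Sigma J B \<union> Sigma ?M Q) =
        Sigma (I \<union> J) B \<union> Sigma ?M (\<lambda>a. P a \<union> Q a)" by blast
    also have "\<dots> = Sigma (?A - ?M) B \<union> Sigma ?M (\<lambda>a. B a - ?N a)"
      using IJ(1) PQ(1) by (simp cong: Sigma_cong)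
    also have "\<dots> = ?S - Sigma ?M ?N" using MA by blast
    finally show ?thesis .
  qed
  moreover have "(Sigma I B \<union> Sigma ?M P) \<inter> (Sigma J B \<union> Sigma ?M Q) = {}"
    using IJ PQ(2) by blast
  moreover have "pattern ?u (Sigma I B \<union> Sigma ?M P \<union> Sigma ?M ?N) \<in> X"
    using IJ(1) PQ(1) by (intro part X IX PX) blast+
  moreover have "pattern ?u (Sigma J B \<union> Sigma ?M Q \<union> Sigma ?M ?N) \<in> Y"
    using IJ(1) PQ(1) by (intro part Y JY QY) blast+
  ultimately show "lr_inflation \<pi> \<sigma>s \<in> ?K"
    unfolding eq pattern_in_lr_merge_iff[OF S X(2) Y(2)] minS by blast
qed

section \<open>The largest class inside a set closed under LR-inflations\<close>

text \<open>The largest permutation class contained in \<open>K\<close>.\<close>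

definition hereditary_part :: "perm set \<Rightarrow> perm set" where
  "hereditary_part K = {\<pi>. is_perm \<pi> \<and> (\<forall>\<sigma>. is_perm \<sigma> \<and> contains_perm \<pi> \<sigma> \<longrightarrow> \<sigma> \<in> K)}"

lemma pattern_in_hereditary_part_iff:
  assumes "finite A" "A \<noteq> {}" "inj_on v A"
  shows "pattern v A \<in> hereditary_part K \<longleftrightarrow> (\<forall>B. B \<subseteq> A \<and> B \<noteq> {} \<longrightarrow> pattern v B \<in> K)"
proof -
  have perm: "is_perm (pattern v B)" if "B \<subseteq> A" "B \<noteq> {}" for B
  proof (rule is_perm_pattern)
    show "finite B" using that(1) assms(1) by (rule finite_subset)
    show "inj_on v B" using assms(3) that(1) by (rule inj_on_subset)
  qed (rule that(2))
  show ?thesis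
  proof
    assume h: "pattern v A \<in> hereditary_part K"
    show "\<forall>B. B \<subseteq> A \<and> B \<noteq> {} \<longrightarrow> pattern v B \<in> K"
    proof (intro allI impI)
      fix B assume B: "B \<subseteq> A \<and> B \<noteq> {}"
      then have "is_perm (pattern v B)" by (intro perm) auto
      moreover from this have "contains_perm (pattern v A) (pattern v B)"
        using B by (subst contains_pattern_iff[OF assms(1,3)]) auto
      ultimately show "pattern v B \<in> K" using h unfolding hereditary_part_def by blast
    qed
  next
    assume sub: "\<forall>B. B \<subseteq> A \<and> B \<noteq> {} \<longrightarrow> pattern v B \<in> K"
    have "\<sigma> \<in> K" if \<sigma>: "is_perm \<sigma>" "contains_perm (pattern v A) \<sigma>" for \<sigma>
    proof -
      obtain B where "B \<subseteq> A" "B \<noteq> {}" "\<sigma> = pattern v B"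
        using \<sigma>(2) unfolding contains_pattern_iff[OF assms(1,3) \<sigma>(1)] by blast
      then show ?thesis using sub by blast
    qed
    then show "pattern v A \<in> hereditary_part K"
      using perm[OF order_refl assms(2)] unfolding hereditary_part_def by blast
  qed
qed

lemma hereditary_part_subset: "hereditary_part K \<subseteq> K"
proof
  fix \<pi> assume h: "\<pi> \<in> hereditary_part K"
  then have p: "is_perm \<pi>" by (simp add: hereditary_part_def)
  have ne: "{..<length \<pi>} \<noteq> {}" by (rule perm_indices_nonempty[OF p])
  have "pattern ((!) \<pi>) {..<length \<pi>} \<in> hereditary_part K"
    unfolding pattern_perm_id[OF p] by (rule h)
  then have "pattern ((!) \<pi>) {..<length \<pi>} \<in> K"
    using ne unfolding pattern_in_hereditary_part_iff[OF finite_lessThan ne perm_inj_on[OF p]]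
    by blast
  then show "\<pi> \<in> K" unfolding pattern_perm_id[OF p] .
qed

lemma perm_class_hereditary_part: "perm_class (hereditary_part K)"
  unfolding perm_class_def
proof (intro conjI ballI allI impI)
  fix \<pi> assume "\<pi> \<in> hereditary_part K"
  then show "is_perm \<pi>" by (simp add: hereditary_part_def)
next
  fix \<pi> \<sigma> assume h: "\<pi> \<in> hereditary_part K" and \<sigma>: "is_perm \<sigma> \<and> contains_perm \<pi> \<sigma>"
  then have p: "is_perm \<pi>" by (simp add: hereditary_part_def)
  let ?A = "{..<length \<pi>}" and ?v = "(!) \<pi>"
  have A: "finite ?A" "?A \<noteq> {}" "inj_on ?v ?A"
    using perm_indices_nonempty[OF p] perm_inj_on[OF p] by simp_all
  obtain B where B: "B \<subseteq> ?A" "B \<noteq> {}" "\<sigma> = pattern ?v B"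
    using \<sigma> contains_pattern_iff[OF A(1,3), of \<sigma>] unfolding pattern_perm_id[OF p] by blast
  have "\<forall>B. B \<subseteq> ?A \<and> B \<noteq> {} \<longrightarrow> pattern ?v B \<in> K"
    using h pattern_in_hereditary_part_iff[OF A, of K] unfolding pattern_perm_id[OF p] by blast
  then have "\<forall>B'. B' \<subseteq> B \<and> B' \<noteq> {} \<longrightarrow> pattern ?v B' \<in> K" using B(1) by blast
  moreover have "finite B" using B(1) A(1) by (rule finite_subset)
  moreover have "inj_on ?v B" using A(3) B(1) by (rule inj_on_subset)
  ultimately show "\<sigma> \<in> hereditary_part K"
    unfolding B(3) using B(2) by (subst pattern_in_hereditary_part_iff) blast+
qed

text \<open>
  A subset \<open>T\<close> of the points of an inflation is again a disjoint sum, of its sections over its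
  projection. The points that become LR-minima only in the projection have one-point sections, so
  \<open>T\<close> is the index set of an LR-inflation of permutations in \<open>K\<close>.
\<close>

lemma lr_inflation_closed_hereditary_part:
  assumes "lr_inflation_closed K"
  shows "lr_inflation_closed (hereditary_part K)"
  unfolding lr_inflation_closed_def
proof (intro ballI allI impI)
  let ?H = "hereditary_part K"
  fix \<pi> \<sigma>s assume h: "\<pi> \<in> ?H" and \<sigma>s: "length \<sigma>s = card (lr_minima \<pi>) \<and> set \<sigma>s \<subseteq> ?H"
  have perms: "\<forall>\<rho>\<in>?H. is_perm \<rho>" by (simp add: hereditary_part_def)
  have p: "is_perm \<pi>" using h perms by blast
  let ?A = "{..<length \<pi>}" and ?v = "(!) \<pi>"
  let ?M = "lr_min_on ?v ?A"
  have A: "finite ?A" "?A \<noteq> {}" "inj_on ?v ?A"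
    using perm_indices_nonempty[OF p] perm_inj_on[OF p] by simp_all
  obtain B w where eq: "lr_inflation \<pi> \<sigma>s = pattern (infl_val ?v w) (Sigma ?A B)"
    and B: "\<And>a. a \<in> ?A \<Longrightarrow> finite (B a) \<and> B a \<noteq> {} \<and> inj_on (w a :: nat \<Rightarrow> nat) (B a)"
    and sing: "\<And>a. a \<in> ?A - ?M \<Longrightarrow> is_singleton (B a)"
    and blocks: "\<And>a. a \<in> ?M \<Longrightarrow> pattern (w a) (B a) \<in> ?H"
    using lr_inflation_as_pattern[OF p _ _ perms, of \<sigma>s] \<sigma>s unfolding lr_minima_eq
    by (metis DiffD1 DiffD2 lessThan_iff)
  let ?S = "Sigma ?A B" and ?u = "infl_val ?v w"
  have S: "finite ?S" "?S \<noteq> {}" "inj_on ?u ?S"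
    using A B by (auto intro!: inj_on_infl_val)
  have subA: "pattern ?v A' \<in> K" if "A' \<subseteq> ?A" "A' \<noteq> {}" for A'
    using h that pattern_in_hereditary_part_iff[OF A, of K] unfolding pattern_perm_id[OF p] by blast
  \<comment> \<open>The block of an element that becomes an LR-minimum only after the deletion.\<close>
  have one: "[1] \<in> K"
  proof -
    obtain a where "a \<in> ?A" using A(2) by blast
    then have "pattern ?v {a} \<in> K" by (intro subA) auto
    then show ?thesis by (simp add: pattern_singleton)
  qed
  have "pattern ?u T \<in> K" if T: "T \<subseteq> ?S" "T \<noteq> {}" for T
  proof -
    let ?A' = "fst ` T" and ?B' = "\<lambda>a. T `` {a}"
    have T': "T = Sigma ?A' ?B'" by force
    have sub: "?A' \<subseteq> ?A" using T(1) by auto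
    have B': "?B' a \<subseteq> B a" "?B' a \<noteq> {}" if "a \<in> ?A'" for a using that T(1) by auto
    have fB': "finite (?B' a)" "inj_on (w a) (?B' a)" if "a \<in> ?A'" for a
      using B[of a] B'[OF that] that sub by (meson finite_subset inj_on_subset subsetD)+
    have sing': "is_singleton (?B' a)" if a: "a \<in> ?A'" "a \<notin> ?M" for a
    proof -
      have "is_singleton (B a)" using a sub by (intro sing) auto
      then show ?thesis using B'[OF a(1)] by (metis is_singleton_def subset_singletonD)
    qed
    have "pattern ?u (Sigma ?A' ?B') \<in> K"
    proof (rule lr_inflation_closed_pattern[OF assms])
      show "finite ?A'" using sub finite_subset by blast
      show "?A' \<noteq> {}" using T(2) by simp
      show "inj_on ?v ?A'" using sub A(3) inj_on_subset by blast
      show "pattern ?v ?A' \<in> K" using subA[OF sub] T(2) by simp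
      show "finite (?B' a) \<and> ?B' a \<noteq> {} \<and> inj_on (w a) (?B' a)" if "a \<in> ?A'" for a
        using fB'[OF that] B'[OF that] by blast
      show "is_singleton (?B' a)" if "a \<in> ?A' - lr_min_on ?v ?A'" for a
        using that sing' lr_min_on_antimono[OF sub, of ?v] by blast
      fix a assume "a \<in> lr_min_on ?v ?A'"
      then have a: "a \<in> ?A'" using lr_min_on_subset by blast
      show "pattern (w a) (?B' a) \<in> K"
      proof (cases "a \<in> ?M")
        case True
        then show ?thesis
          using blocks[OF True] B'[OF a] B[of a] a sub
            pattern_in_hereditary_part_iff[of "B a" "w a" K] by blast
      next
        case False
        show ?thesis unfolding pattern_singleton[OF sing'[OF a False]] by (rule one)
      qed
    qed
    then show ?thesis unfolding T'[symmetric] .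
  qed
  then show "lr_inflation \<pi> \<sigma>s \<in> ?H"
    unfolding eq pattern_in_hereditary_part_iff[OF S] by blast
qed

text \<open>
  To bound the LR-closure of a class, closure under LR-inflations is enough: the bound \<open>K\<close> need not
  be a class itself.
\<close>

lemma lr_closure_subset_if_lr_inflation_closed:
  assumes "perm_class C" "C \<subseteq> K" "lr_inflation_closed K"
  shows "lr_closure C \<subseteq> K"
proof -
  have "C \<subseteq> hereditary_part K"
    using assms(1,2) by (auto simp: perm_class_def hereditary_part_def)
  then have "lr_closure C \<subseteq> hereditary_part K"
    by (intro lr_closure_least perm_class_hereditary_part
        lr_inflation_closed_hereditary_part assms(3))
  then show ?thesis using hereditary_part_subset by blast
qed

theorem proposition4p7:
  fixes C D E :: "perm set"
  assumes "perm_class C" and "perm_class D" and "perm_class E"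
    and "C \<subseteq> D \<odot>\<^sub>L\<^sub>R E"
  shows "lr_closure C \<subseteq> lr_closure D \<odot>\<^sub>L\<^sub>R lr_closure E \<and>
    (\<not> C \<subseteq> lr_closure D \<and> \<not> C \<subseteq> lr_closure E \<longrightarrow>
      nontrivial_lr_splitting (lr_closure C) {#lr_closure D, lr_closure E#} \<and>
      lr_splittable (lr_closure C))"
proof (intro conjI impI)
  have cls: "perm_class (lr_closure C)" "perm_class (lr_closure D)" "perm_class (lr_closure E)"
    using assms(1-3) by (simp_all add: perm_class_lr_closure)
  have "D \<odot>\<^sub>L\<^sub>R E \<subseteq> lr_closure D \<odot>\<^sub>L\<^sub>R lr_closure E"
    using lr_closure_superset[of D] lr_closure_superset[of E] unfolding lr_merge_def by blast
  then have "C \<subseteq> lr_closure D \<odot>\<^sub>L\<^sub>R lr_closure E" using assms(4) by blast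
  moreover have "lr_inflation_closed (lr_closure D \<odot>\<^sub>L\<^sub>R lr_closure E)"
    using cls by (intro lr_inflation_closed_lr_merge lr_closure_closed) (auto simp: perm_class_def)
  ultimately show sub: "lr_closure C \<subseteq> lr_closure D \<odot>\<^sub>L\<^sub>R lr_closure E"
    by (intro lr_closure_subset_if_lr_inflation_closed assms(1))
  assume not: "\<not> C \<subseteq> lr_closure D \<and> \<not> C \<subseteq> lr_closure E"
  have "lr_splitting (lr_closure C) {#lr_closure D, lr_closure E#}"
    unfolding lr_splitting_def
  proof (intro conjI exI)
    show "{#lr_closure D, lr_closure E#} = mset (lr_closure D # [lr_closure E])" by simp
    show "lr_closure C \<subseteq> foldl (\<odot>\<^sub>L\<^sub>R) (lr_closure D) [lr_closure E]" using sub by simp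
  qed (use cls in auto)
  then show *: "nontrivial_lr_splitting (lr_closure C) {#lr_closure D, lr_closure E#}"
    unfolding nontrivial_lr_splitting_def using not lr_closure_superset[of C] by auto
  show "lr_splittable (lr_closure C)"
    unfolding lr_splittable_def using * by blast
qed

end
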